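(* Consider the Diophantine equation $xy = z^3$ in positive integers $x, y, z$. A triple $(x,y,z)$ of positive integers is a solution of this equation if and only if there exist positive integers $d, v_1, v_2, m, l$ with $\gcd(v_1,v_2)=1$ and $\gcd(m,l)=1$ such that $$x = d^3 v_1^2 v_2 m^3,\qquad y = d^3 v_1 v_2^2 l^3,\qquad z = d^2 v_1 v_2 m l .$$ *)

theory Defs
  imports Complex_Main
begin

end

(* Split off from x and y the largest common cube d^3, and from the cofactors their largest cubes
   m^3 and l^3; maximality of d makes m and l coprime. The remaining cube-free parts s and t have
   a cube w^3 as product. Then w divides both s and t, and v1 = s / w, v2 = t / w. *)

theory Submission
  imports Defs
begin

text \<open>Take \<open>k\<close> maximal with \<open>k ^ e\<close> dividing \<open>n\<close>: a
  further factor \<open>j ^ e\<close> of the cofactor could be absorbed into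
  \<open>(k * j) ^ e\<close>, so \<open>j\<close> must be 1.\<close>

lemma power_free_decomposition:
  fixes n :: nat
  assumes "n > 0" and "e > 0"
  obtains k r where "n = k ^ e * r" and "\<forall>j. j ^ e dvd r \<longrightarrow> j = 1"
proof -
  let ?K = "{k. k ^ e dvd n}"
  have bounded: "k \<le> n" if "k ^ e dvd n" for k
    using that assms by (meson dvd_imp_le dvd_power dvd_trans)
  have fin: "finite ?K"
    by (rule finite_subset[of _ "{..n}"]) (auto intro: bounded)
  have one: "1 \<in> ?K" by simp
  define k where "k = Max ?K"
  have "k \<in> ?K" unfolding k_def using Max_in[OF fin] one by blast
  then obtain r where r: "n = k ^ e * r" by auto
  have "k > 0" using r assms by (cases "k = 0") auto
  have "j = 1" if j: "j ^ e dvd r" for j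
  proof -
    have "(k * j) ^ e dvd n"
      using j r by (simp add: power_mult_distrib mult_dvd_mono)
    then have "k * j \<le> k"
      unfolding k_def using Max_ge[OF fin] by blast
    moreover have "j \<noteq> 0"
      using j r assms by (cases "j = 0") (auto simp: power_0_left)
    ultimately show "j = 1" using \<open>k > 0\<close> by simp
  qed
  with r show thesis using that by blast
qed

text \<open>Cancelling \<open>g = gcd s w\<close> leaves \<open>a * t = b ^ 3 * g ^ 2\<close> with
  \<open>a\<close> and \<open>b\<close> coprime, so \<open>b ^ 3\<close> has to go into
  \<open>t\<close>. For cube-free \<open>t\<close> this forces \<open>b = 1\<close>, that is,
  \<open>w\<close> divides \<open>s\<close>.\<close>

lemma cube_dvd_of_mult_eq_cube:
  fixes s t w :: nat
  assumes eq: "s * t = w ^ 3" and "w > 0"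
  obtains b where "w = gcd s w * b" and "b ^ 3 dvd t"
proof -
  define g where "g = gcd s w"
  have "g > 0" using \<open>w > 0\<close> by (simp add: g_def)
  obtain a b where ab: "s = a * g" "w = b * g" "coprime a b"
    using gcd_coprime_exists[of s w] \<open>g > 0\<close> unfolding g_def by blast
  have "g * (a * t) = g * (b ^ 3 * g ^ 2)"
    using eq ab(1,2) by (simp add: algebra_simps power3_eq_cube power2_eq_square)
  then have "b ^ 3 dvd a * t" using \<open>g > 0\<close> by simp
  then have "b ^ 3 dvd t"
    using ab(3) by (simp add: coprime_dvd_mult_right_iff coprime_commute)
  moreover have "w = gcd s w * b" using ab(2) unfolding g_def by (simp only: mult.commute)
  ultimately show thesis using that by blast
qed

text \<open>Prime by prime, the exponents in \<open>s\<close> and \<open>t\<close> are at most 2 and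
  add up to a multiple of 3, hence are (0,0), (2,1) or (1,2); \<open>v1\<close> collects the primes
  of the second type, \<open>v2\<close> those of the third. The proof gets there by divisibility
  alone.\<close>

lemma cube_free_mult_eq_cube:
  fixes s t w :: nat
  assumes eq: "s * t = w ^ 3" and "w > 0"
    and s: "\<forall>j. j ^ 3 dvd s \<longrightarrow> j = 1" and t: "\<forall>j. j ^ 3 dvd t \<longrightarrow> j = 1"
  obtains v1 v2 where "gcd v1 v2 = 1" and "s = v1 ^ 2 * v2" and "t = v1 * v2 ^ 2" and "w = v1 * v2"
proof -
  obtain b where "w = gcd s w * b" "b ^ 3 dvd t"
    by (rule cube_dvd_of_mult_eq_cube[OF eq \<open>w > 0\<close>])
  moreover from this t have "b = 1" by blast
  ultimately have "w dvd s" by (metis gcd_dvd1 mult.right_neutral)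
  then obtain v1 where v1: "s = w * v1" ..
  have "t * s = w ^ 3" using eq by (simp add: mult.commute)
  then obtain c where "w = gcd t w * c" "c ^ 3 dvd s"
    by (rule cube_dvd_of_mult_eq_cube[OF _ \<open>w > 0\<close>])
  moreover from this s have "c = 1" by blast
  ultimately have "w dvd t" by (metis gcd_dvd1 mult.right_neutral)
  then obtain v2 where v2: "t = w * v2" ..
  have "w ^ 2 * w = w ^ 2 * (v1 * v2)"
    using eq unfolding v1 v2 by (simp only: power3_eq_cube power2_eq_square mult_ac)
  then have w: "w = v1 * v2" using \<open>w > 0\<close> by simp
  \<comment> \<open>The right-hand side is \<open>s = w * v1\<close>, which is cube-free.\<close>
  have "gcd v1 v2 ^ 3 dvd v1 * v2 * v1"
    by (simp add: power3_eq_cube mult_dvd_mono)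
  then have "gcd v1 v2 = 1" using s v1 w by simp
  with v1 v2 w show thesis using that by (simp add: power2_eq_square mult_ac)
qed

theorem theorem3:
  fixes x y z :: nat
  assumes "x > 0" and "y > 0" and "z > 0"
  shows "x * y = z ^ 3 \<longleftrightarrow>
    (\<exists>d v1 v2 m l :: nat. d > 0 \<and> v1 > 0 \<and> v2 > 0 \<and> m > 0 \<and> l > 0 \<and>
       gcd v1 v2 = 1 \<and> gcd m l = 1 \<and>
       x = d ^ 3 * v1 ^ 2 * v2 * m ^ 3 \<and>
       y = d ^ 3 * v1 * v2 ^ 2 * l ^ 3 \<and>
       z = d ^ 2 * v1 * v2 * m * l)"
proof
  assume xy: "x * y = z ^ 3"
  define h where "h = gcd x y"
  have "h > 0" using assms by (simp add: h_def)
  obtain x1 y1 where x1: "x = x1 * h" and y1: "y = y1 * h" and cop: "coprime x1 y1"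
    using gcd_coprime_exists[of x y] \<open>h > 0\<close> unfolding h_def by blast
  \<comment> \<open>The largest cube dividing both \<open>x\<close> and \<open>y\<close> is the
    largest cube dividing their gcd. The cofactors of \<open>d ^ 3\<close> are then
    \<open>x1 * e\<close> and \<open>y1 * e\<close>.\<close>
  obtain d e where h: "h = d ^ 3 * e" and e: "\<forall>j. j ^ 3 dvd e \<longrightarrow> j = 1"
    by (rule power_free_decomposition[where e = 3, OF \<open>h > 0\<close> zero_less_numeral])
  have "x1 * e > 0" "y1 * e > 0" using assms x1 y1 h by auto
  obtain m s where m: "x1 * e = m ^ 3 * s" and s: "\<forall>j. j ^ 3 dvd s \<longrightarrow> j = 1"
    by (rule power_free_decomposition[where e = 3, OF \<open>x1 * e > 0\<close> zero_less_numeral])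
  obtain l t where l: "y1 * e = l ^ 3 * t" and t: "\<forall>j. j ^ 3 dvd t \<longrightarrow> j = 1"
    by (rule power_free_decomposition[where e = 3, OF \<open>y1 * e > 0\<close> zero_less_numeral])
  have x: "x = d ^ 3 * m ^ 3 * s" using x1 h m by (simp add: mult_ac)
  have y: "y = d ^ 3 * l ^ 3 * t" using y1 h l by (simp add: mult_ac)
  have pos: "d > 0" "m > 0" "l > 0" "s > 0" "t > 0" using assms x y by auto
  \<comment> \<open>The cube of \<open>gcd m l\<close> divides both cofactors, hence their gcd. As
    \<open>x1\<close> and \<open>y1\<close> are coprime, that gcd is the cube-free
    \<open>e\<close>.\<close>
  have "gcd m l ^ 3 dvd m ^ 3 * s" "gcd m l ^ 3 dvd l ^ 3 * t"
    by (simp_all add: dvd_power_same)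
  then have "gcd m l ^ 3 dvd gcd (x1 * e) (y1 * e)" using m l by simp
  also have "gcd (x1 * e) (y1 * e) = e"
    using cop by (simp add: gcd_mult_distrib_nat[symmetric] mult.commute[of _ e])
  finally have ml: "gcd m l = 1" using e by blast
  \<comment> \<open>The two factors \<open>d ^ 3\<close> combine to \<open>(d ^ 2) ^ 3\<close>,
    whence the exponent 2 of \<open>d\<close> in \<open>z\<close>.\<close>
  have cube: "(d ^ 2 * m * l) ^ 3 * (s * t) = z ^ 3"
    using xy x y by (simp add: algebra_simps power_mult_distrib flip: power_mult power_add)
  then have "(d ^ 2 * m * l) ^ 3 dvd z ^ 3" by (metis dvd_triv_left)
  then have "d ^ 2 * m * l dvd z" by simp
  then obtain w where z: "z = d ^ 2 * m * l * w" ..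
  have st: "s * t = w ^ 3" using cube z pos by (simp add: power_mult_distrib)
  have "w > 0" using assms z by auto
  obtain v1 v2 where v: "gcd v1 v2 = 1" "s = v1 ^ 2 * v2" "t = v1 * v2 ^ 2" "w = v1 * v2"
    by (rule cube_free_mult_eq_cube[OF st \<open>w > 0\<close> s t])
  have "v1 > 0" "v2 > 0" using v \<open>w > 0\<close> by auto
  moreover have "x = d ^ 3 * v1 ^ 2 * v2 * m ^ 3" "y = d ^ 3 * v1 * v2 ^ 2 * l ^ 3"
    "z = d ^ 2 * v1 * v2 * m * l"
    using x y z v by (simp_all add: mult_ac)
  ultimately show "\<exists>d v1 v2 m l :: nat. d > 0 \<and> v1 > 0 \<and> v2 > 0 \<and> m > 0 \<and> l > 0 \<and>
       gcd v1 v2 = 1 \<and> gcd m l = 1 \<and>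
       x = d ^ 3 * v1 ^ 2 * v2 * m ^ 3 \<and>
       y = d ^ 3 * v1 * v2 ^ 2 * l ^ 3 \<and>
       z = d ^ 2 * v1 * v2 * m * l"
    using pos v(1) ml
    by (intro exI[of _ d] exI[of _ v1] exI[of _ v2] exI[of _ m] exI[of _ l] conjI)
\<comment> \<open>Conversely, after substitution both sides equal
  \<open>d ^ 6 * v1 ^ 3 * v2 ^ 3 * m ^ 3 * l ^ 3\<close>.\<close>
qed (elim exE conjE, simp add: power2_eq_square power3_eq_cube)

end
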